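(* Consider the backward Euler scheme: given $u_h^0\in\mathcal{C}^{per}_{N\times N}$, for $n\ge 0$ find $u_h^{n+1},\omega_h^{n+1}\in\mathcal{C}^{per}_{N\times N}$ such that $$\frac{u_h^{n+1}-u_h^n}{\tau}=\Delta_h\omega_h^{n+1},\qquad \omega_h^{n+1}=F'(u_h^{n+1})+\varepsilon^2[J\circledast\mathbf 1]u_h^{n+1}-\varepsilon^2[J\circledast u_h^{n+1}],$$ with time step $\tau>0$. Then the total mass is conserved: every solution satisfies $(u_h^{n+1}-u_h^n\|\mathbf 1)=0$ for all $n\ge 0$. Moreover, there is a constant $C_J>0$, depending on the kernel $J$ but independent of $h$, such that if $$\tau\le\frac{2\gamma_0}{C_J\varepsilon^4},$$ then the scheme is uniquely solvable (for every $n\geq 0$ and given $u_h^n$ there is exactly one pair $(u_h^{n+1},\omega_h^{n+1})$ satisfying it) and energy stable: $E_h(u_h^{n+1})\le E_h(u_h^n)$ for all $n\ge 0$.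
   Context: Setting. $\Omega=(0,L)\times(0,L)$, $h=L/N$ with $N\in\mathbb{Z}^+$, and $\varepsilon>0$. The kernel $J:\mathbb{R}^2\to\mathbb{R}$ is $C^\infty$, $\Omega$-periodic ($L$-periodic in each variable) and even ($J(\mathbf x)=J(-\mathbf x)$), with $J*1=\int_\Omega J\,d\mathbf x>0$. $\mathcal{C}^{per}_{N\times N}$ is the finite-dimensional space of real periodic cell-centered grid functions $\phi=(\phi_{i,j})$ (values at $((i-\tfrac12)h,(j-\tfrac12)h)$), extended $N$-periodically in both indices $i,j\in\mathbb{Z}$. $\mathbf 1$ is the constant grid function $1$; products, powers and $F(u_h),F'(u_h)$ are taken componentwise. $(\phi\|\psi)=\sum_{i,j=1}^N\phi_{i,j}\psi_{i,j}$ and $\|\phi\|_2^2=h^2(\phi\|\phi)$. Discrete Laplacian: $(\Delta_h\phi)_{i,j}=h^{-2}(\phi_{i+1,j}+\phi_{i-1,j}+\phi_{i,j+1}+\phi_{i,j-1}-4\phi_{i,j})$. Discrete convolution: with $J_{k+\frac12,l+\frac12}:=J(kh,lh)$, $[J\circledast\phi]_{i,j}=h^2\sum_{k=1}^N\sum_{l=1}^N J_{k+\frac12,l+\frac12}\,\phi_{i-k,j-l}$. $[J\circledast\mathbf 1]$ is a constant grid function, identified with the number $h^2\sum_{k,l=1}^N J(kh,lh)$. Standing assumption: $\gamma:=\varepsilon^2(J*1)-1>0$ and its discrete analogue $\gamma_0:=\varepsilon^2[J\circledast\mathbf 1]-1>0$. Potential: $F(r)=\frac14(r^2-1)^2$.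 Discrete energy: $E_h(u_h)=h^2(F(u_h)\|\mathbf 1)+\frac{\varepsilon^2[J\circledast\mathbf 1]}{2}\|u_h\|_2^2-\frac{\varepsilon^2}{2}h^2(u_h\|[J\circledast u_h])$. *)

theory Defs
  imports "HOL-Analysis.Analysis"
begin

fun Ck :: "nat \<Rightarrow> ('a::real_normed_vector \<Rightarrow> real) \<Rightarrow> bool" where
  "Ck 0 f \<longleftrightarrow> continuous_on UNIV f"
| "Ck (Suc k) f \<longleftrightarrow>
     (\<forall>x. f differentiable (at x)) \<and> (\<forall>v. Ck k (\<lambda>x. frechet_derivative f (at x) v))"

definition smooth :: "('a::real_normed_vector \<Rightarrow> real) \<Rightarrow> bool" where
  "smooth f \<longleftrightarrow> (\<forall>k. Ck k f)"

text \<open>A grid function is represented by its periodic extension to all integer indices;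
  \<open>\<phi> i j\<close> is the value at the cell centre \<open>((i - 1/2) h, (j - 1/2) h)\<close>, \<open>h = L / N\<close>.\<close>

type_synonym grid_fun = "int \<Rightarrow> int \<Rightarrow> real"

definition grid_per :: "nat \<Rightarrow> grid_fun set" where
  "grid_per N = {\<phi>. \<forall>i j. \<phi> (i + int N) j = \<phi> i j \<and> \<phi> i (j + int N) = \<phi> i j}"

definition grid_inner :: "nat \<Rightarrow> grid_fun \<Rightarrow> grid_fun \<Rightarrow> real" where
  "grid_inner N \<phi> \<psi> = (\<Sum>i=1..int N. \<Sum>j=1..int N. \<phi> i j * \<psi> i j)"

definition grid_norm2 :: "real \<Rightarrow> nat \<Rightarrow> grid_fun \<Rightarrow> real" where
  "grid_norm2 h N \<phi> = sqrt (h\<^sup>2 * grid_inner N \<phi> \<phi>)"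

definition laplacian_h :: "real \<Rightarrow> grid_fun \<Rightarrow> grid_fun" where
  "laplacian_h h \<phi> = (\<lambda>i j.
     (\<phi> (i + 1) j + \<phi> (i - 1) j + \<phi> i (j + 1) + \<phi> i (j - 1) - 4 * \<phi> i j) / h\<^sup>2)"

definition conv_h :: "real \<Rightarrow> nat \<Rightarrow> (real \<times> real \<Rightarrow> real) \<Rightarrow> grid_fun \<Rightarrow> grid_fun" where
  "conv_h h N J \<phi> = (\<lambda>i j.
     h\<^sup>2 * (\<Sum>k=1..int N. \<Sum>l=1..int N. J (of_int k * h, of_int l * h) * \<phi> (i - k) (j - l)))"

definition conv_h_one :: "real \<Rightarrow> nat \<Rightarrow> (real \<times> real \<Rightarrow> real) \<Rightarrow> real" where
  "conv_h_one h N J = h\<^sup>2 * (\<Sum>k=1..int N. \<Sum>l=1..int N. J (of_int k * h, of_int l * h))"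

lemma conv_h_const_one: "conv_h h N J (\<lambda>_ _. 1) = (\<lambda>_ _. conv_h_one h N J)"
  by (simp add: conv_h_def conv_h_one_def)

definition potential :: "real \<Rightarrow> real" where
  "potential r = (r\<^sup>2 - 1)\<^sup>2 / 4"

lemma deriv_potential: "deriv potential r = r ^ 3 - r"
proof -
  have "(potential has_real_derivative (r ^ 3 - r)) (at r)"
    unfolding potential_def
    by (auto intro!: derivative_eq_intros simp: power2_eq_square power3_eq_cube field_simps)
  then show ?thesis by (rule DERIV_imp_deriv)
qed

definition energy_h ::
    "real \<Rightarrow> nat \<Rightarrow> (real \<times> real \<Rightarrow> real) \<Rightarrow> real \<Rightarrow> grid_fun \<Rightarrow> real" where
  "energy_h h N J \<epsilon> u =
     h\<^sup>2 * grid_inner N (\<lambda>i j. potential (u i j)) (\<lambda>_ _. 1)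
     + \<epsilon>\<^sup>2 * conv_h_one h N J / 2 * (grid_norm2 h N u)\<^sup>2
     - \<epsilon>\<^sup>2 / 2 * h\<^sup>2 * grid_inner N u (conv_h h N J u)"

text \<open>One step of the scheme: from \<open>v\<close> to the new pair \<open>(u, \<omega>)\<close>.\<close>

definition backward_euler_step ::
    "real \<Rightarrow> nat \<Rightarrow> (real \<times> real \<Rightarrow> real) \<Rightarrow> real \<Rightarrow> real
      \<Rightarrow> grid_fun \<Rightarrow> grid_fun \<Rightarrow> grid_fun \<Rightarrow> bool" where
  "backward_euler_step h N J \<epsilon> \<tau> v u \<omega> \<longleftrightarrow>
     u \<in> grid_per N \<and> \<omega> \<in> grid_per N \<and>
     (\<forall>i j. (u i j - v i j) / \<tau> = laplacian_h h \<omega> i j) \<and>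
     (\<forall>i j. \<omega> i j = deriv potential (u i j) + \<epsilon>\<^sup>2 * conv_h_one h N J * u i j
                       - \<epsilon>\<^sup>2 * conv_h h N J u i j)"

text \<open>The value \<open>\<omega> 0\<close> is not part of the scheme and remains unconstrained.\<close>

definition backward_euler ::
    "real \<Rightarrow> nat \<Rightarrow> (real \<times> real \<Rightarrow> real) \<Rightarrow> real \<Rightarrow> real
      \<Rightarrow> (nat \<Rightarrow> grid_fun) \<Rightarrow> (nat \<Rightarrow> grid_fun) \<Rightarrow> bool" where
  "backward_euler h N J \<epsilon> \<tau> u \<omega> \<longleftrightarrow>
     u 0 \<in> grid_per N \<and>
     (\<forall>n. backward_euler_step h N J \<epsilon> \<tau> (u n) (u (Suc n)) (\<omega> (Suc n)))"

definition gamma_cont :: "real \<Rightarrow> (real \<times> real \<Rightarrow> real) \<Rightarrow> real \<Rightarrow> real" where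
  "gamma_cont L J \<epsilon> = \<epsilon>\<^sup>2 * integral ({0<..<L} \<times> {0<..<L}) J - 1"

definition gamma_h :: "real \<Rightarrow> nat \<Rightarrow> (real \<times> real \<Rightarrow> real) \<Rightarrow> real \<Rightarrow> real" where
  "gamma_h h N J \<epsilon> = \<epsilon>\<^sup>2 * conv_h_one h N J - 1"

end

theory Submission
  imports Defs
begin

text \<open>Everything rests on one estimate: if \<open>w = \<tau> \<Delta>\<^sub>h \<theta>\<close>, then summation by parts, the Lipschitz
  continuity of \<open>J\<close> and AM-GM give \<open>\<epsilon>\<^sup>2 h\<^sup>2 (w | J \<circledast> w) \<le> \<tau> |\<nabla>\<^sub>h \<theta>|\<^sup>2 + \<gamma>\<^sub>0 |w|\<^sup>2\<close>
  under the time step restriction with \<open>C\<^sub>J = L\<^sup>4 Lip(J)\<^sup>2\<close>. Applied to the difference of two solutions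
  of a step it yields uniqueness, applied to the increment of a step it yields energy decay.
  Existence holds for every \<open>\<tau>\<close>, by minimisation over \<open>\<omega>\<close> in place of \<open>u\<close>, which
  avoids inverting \<open>\<Delta>\<^sub>h\<close>.\<close>

text \<open>The obstacle is that \<open>- \<kappa> * (w | C w)\<close> enters with the wrong sign,
  and an operator norm bound of \<open>C\<close> cannot be absorbed: on constants \<open>C\<close>
  has the eigenvalue \<open>conv_h_one\<close>, and \<open>\<epsilon>\<^sup>2 * conv_h_one\<close>
  equals \<open>gamma_h + 1\<close>, which exceeds \<open>gamma_h\<close>. Both in uniqueness and in
  decay, however, \<open>w\<close> is a discrete Laplacian times \<open>\<tau>\<close>. Moving one
  difference onto the kernel gains the factor \<open>\<tau>\<close>; the gradient of \<theta> that
  is left over is paid for by the dissipation of the scheme, and only the remainder has to fit below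
  \<open>gamma_h\<close>. Existence needs no such balance: the energy need not be convex, but a
  critical point suffices, and the quartic growth of the potential provides a minimiser.\<close>

section \<open>Sums of periodic grid functions\<close>

definition gsum :: "nat \<Rightarrow> grid_fun \<Rightarrow> real" where
  "gsum N f = (\<Sum>(i,j)\<in>{1..int N} \<times> {1..int N}. f i j)"

lemma gsum_nested: "gsum N f = (\<Sum>i=1..int N. \<Sum>j=1..int N. f i j)"
  unfolding gsum_def by (rule sum.cartesian_product [symmetric])

lemma grid_inner_eq_gsum: "grid_inner N \<phi> \<psi> = gsum N (\<lambda>i j. \<phi> i j * \<psi> i j)"
  by (simp add: grid_inner_def gsum_nested)

lemma gsum_add: "gsum N (\<lambda>i j. f i j + g i j) = gsum N f + gsum N g"
  by (simp add: gsum_def case_prod_unfold sum.distrib)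

lemma gsum_diff: "gsum N (\<lambda>i j. f i j - g i j) = gsum N f - gsum N g"
  by (simp add: gsum_def case_prod_unfold sum_subtractf)

lemma gsum_cmult: "gsum N (\<lambda>i j. c * f i j) = c * gsum N f"
  by (simp add: gsum_def case_prod_unfold sum_distrib_left)

lemma gsum_const: "gsum N (\<lambda>i j. c) = (real N)\<^sup>2 * c"
  by (simp add: gsum_def power2_eq_square)

lemma gsum_mono: "(\<And>i j. f i j \<le> g i j) \<Longrightarrow> gsum N f \<le> gsum N g"
  by (auto simp: gsum_def case_prod_unfold intro!: sum_mono)

lemma gsum_nonneg: "(\<And>i j. 0 \<le> f i j) \<Longrightarrow> 0 \<le> gsum N f"
  by (auto simp: gsum_def case_prod_unfold intro!: sum_nonneg)

lemma abs_gsum_le: "\<bar>gsum N f\<bar> \<le> gsum N (\<lambda>i j. \<bar>f i j\<bar>)"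
  by (simp add: gsum_def case_prod_unfold)

lemma gsum_swap:
  "gsum N (\<lambda>i j. gsum N (\<lambda>k l. f i j k l)) = gsum N (\<lambda>k l. gsum N (\<lambda>i j. f i j k l))"
  unfolding gsum_def case_prod_unfold by (rule sum.swap)

lemma gsum_squared_le: "(gsum N f)\<^sup>2 \<le> (real N)\<^sup>2 * gsum N (\<lambda>i j. (f i j)\<^sup>2)"
  using sum_squared_le_sum_of_squares [of "\<lambda>(i,j). f i j" "{1..int N} \<times> {1..int N}"]
  by (simp add: gsum_def case_prod_unfold power2_eq_square mult.commute)

lemma grid_perD:
  assumes "\<phi> \<in> grid_per N"
  shows "\<phi> (i + int N) j = \<phi> i j" "\<phi> i (j + int N) = \<phi> i j"
  using assms by (auto simp: grid_per_def)

lemma grid_per_map: "\<phi> \<in> grid_per N \<Longrightarrow> (\<lambda>i j. f (\<phi> i j)) \<in> grid_per N"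
  by (auto simp: grid_per_def)

lemma grid_per_shift:
  assumes "\<phi> \<in> grid_per N"
  shows "(\<lambda>i j. \<phi> (i + a) (j + b)) \<in> grid_per N"
  using grid_perD [OF assms, of "_ + a" "_ + b"] by (simp add: grid_per_def algebra_simps)

lemma sum_periodic_shift1:
  fixes f :: "int \<Rightarrow> real"
  assumes "\<And>i. f (i + int N) = f i"
  shows "(\<Sum>i=1..int N. f (i + 1)) = (\<Sum>i=1..int N. f i)"
proof (cases "N = 0")
  case False
  have "(\<Sum>i=1..int N. f (i + 1)) = (\<Sum>i=2..int N + 1. f i)"
    by (rule sum.reindex_bij_witness [of _ "\<lambda>i. i - 1" "\<lambda>i. i + 1"]) auto
  also have "{2..int N + 1} = insert (int N + 1) {2..int N}" using False by auto
  also have "(\<Sum>i\<in>\<dots>. f i) = f (int N + 1) + (\<Sum>i=2..int N. f i)" by simp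
  also have "f (int N + 1) = f 1" using assms [of 1] by (simp add: add.commute)
  also have "f 1 + (\<Sum>i=2..int N. f i) = (\<Sum>i\<in>insert 1 {2..int N}. f i)" by simp
  also have "insert 1 {2..int N} = {1..int N}" using False by auto
  finally show ?thesis .
qed simp

lemma sum_periodic_shift:
  fixes f :: "int \<Rightarrow> real"
  assumes per: "\<And>i. f (i + int N) = f i"
  shows "(\<Sum>i=1..int N. f (i + m)) = (\<Sum>i=1..int N. f i)"
proof (induction m rule: int_induct [where k = 0])
  case base
  show ?case by simp
next
  case (step1 m)
  have "f (i + int N + m) = f (i + m)" for i
    using per [of "i + m"] by (simp add: algebra_simps)
  then show ?case
    using sum_periodic_shift1 [of "\<lambda>i. f (i + m)" N] step1 by (simp add: algebra_simps)
next
  case (step2 m)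
  have "f (i + int N + (m - 1)) = f (i + (m - 1))" for i
    using per [of "i + (m - 1)"] by (simp add: algebra_simps)
  then show ?case
    using sum_periodic_shift1 [of "\<lambda>i. f (i + (m - 1))" N] step2 by (simp add: algebra_simps)
qed

lemma sum_periodic_reflect:
  fixes f :: "int \<Rightarrow> real"
  assumes per: "\<And>i. f (i + int N) = f i"
  shows "(\<Sum>i=1..int N. f (m - i)) = (\<Sum>i=1..int N. f i)"
proof -
  \<comment> \<open>Reversing the index range by \<open>i \<mapsto> int N + 1 - i\<close> turns the
    reflection into a shift.\<close>
  have "(\<Sum>i=1..int N. f (m - i)) = (\<Sum>i=1..int N. f (i + (m - int N - 1)))"
    by (rule sum.reindex_bij_witness [of _ "\<lambda>i. int N + 1 - i" "\<lambda>i. int N + 1 - i"])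
      (auto simp: algebra_simps)
  also have "\<dots> = (\<Sum>i=1..int N. f i)" by (rule sum_periodic_shift [of f, OF per])
  finally show ?thesis .
qed

lemma gsum_shift:
  assumes "\<phi> \<in> grid_per N"
  shows "gsum N (\<lambda>i j. \<phi> (i + a) (j + b)) = gsum N \<phi>"
proof -
  have "gsum N (\<lambda>i j. \<phi> (i + a) (j + b)) = (\<Sum>i=1..int N. \<Sum>j=1..int N. \<phi> (i + a) j)"
    unfolding gsum_nested
    by (intro sum.cong refl sum_periodic_shift [of "\<phi> _"] grid_perD(2) [OF assms])
  also have "\<dots> = gsum N \<phi>"
    unfolding gsum_nested
    by (rule sum_periodic_shift [of "\<lambda>i. \<Sum>j=1..int N. \<phi> i j"]) (simp add: grid_perD(1) [OF assms])
  finally show ?thesis .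
qed

lemma gsum_reflect:
  assumes "\<phi> \<in> grid_per N"
  shows "gsum N (\<lambda>i j. \<phi> (a - i) (b - j)) = gsum N \<phi>"
proof -
  have "gsum N (\<lambda>i j. \<phi> (a - i) (b - j)) = (\<Sum>i=1..int N. \<Sum>j=1..int N. \<phi> (a - i) j)"
    unfolding gsum_nested
    by (intro sum.cong refl sum_periodic_reflect [of "\<phi> _"] grid_perD(2) [OF assms])
  also have "\<dots> = gsum N \<phi>"
    unfolding gsum_nested
    by (rule sum_periodic_reflect [of "\<lambda>i. \<Sum>j=1..int N. \<phi> i j"])
      (simp add: grid_perD(1) [OF assms])
  finally show ?thesis .
qed

text \<open>The point \<open>(a, b)\<close> may lie outside the summation range; shift invariance
  moves it to \<open>(1, 1)\<close>. In this way finite sums control the values at all integer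
  indices.\<close>

lemma le_gsum:
  assumes "\<phi> \<in> grid_per N" "N \<ge> 1" "\<And>i j. 0 \<le> \<phi> i j"
  shows "\<phi> a b \<le> gsum N \<phi>"
proof -
  have "\<phi> a b \<le> gsum N (\<lambda>i j. \<phi> (i + (a - 1)) (j + (b - 1)))"
    unfolding gsum_def
    using member_le_sum [of "(1,1)" "{1..int N} \<times> {1..int N}" "\<lambda>(i,j). \<phi> (i + (a - 1)) (j + (b - 1))"]
      assms(2,3) by auto
  also have "\<dots> = gsum N \<phi>" by (rule gsum_shift [OF assms(1)])
  finally show ?thesis .
qed

lemma gsum_eq_0D:
  assumes "\<phi> \<in> grid_per N" "N \<ge> 1" "\<And>i j. 0 \<le> \<phi> i j" "gsum N \<phi> \<le> 0"
  shows "\<phi> a b = 0"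
  using le_gsum [OF assms(1-3), of a b] assms(3) [of a b] assms(4) by linarith

section \<open>Differences, the Dirichlet form and summation by parts\<close>

definition dx :: "grid_fun \<Rightarrow> grid_fun" where
  "dx \<phi> = (\<lambda>i j. \<phi> (i + 1) j - \<phi> i j)"

definition dy :: "grid_fun \<Rightarrow> grid_fun" where
  "dy \<phi> = (\<lambda>i j. \<phi> i (j + 1) - \<phi> i j)"

text \<open>The discrete gradient form without powers of \<open>h\<close>; the factor
  \<open>1 / h\<^sup>2\<close> is therefore visible wherever the Laplacian is traded for it.\<close>

definition dirichlet :: "nat \<Rightarrow> grid_fun \<Rightarrow> grid_fun \<Rightarrow> real" where
  "dirichlet N \<phi> \<psi> = gsum N (\<lambda>i j. dx \<phi> i j * dx \<psi> i j + dy \<phi> i j * dy \<psi> i j)"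

lemma dx_grid_per: "\<phi> \<in> grid_per N \<Longrightarrow> dx \<phi> \<in> grid_per N"
  unfolding dx_def using grid_per_shift [of \<phi> N 1 0]
  by (simp add: grid_per_def)

lemma dy_grid_per: "\<phi> \<in> grid_per N \<Longrightarrow> dy \<phi> \<in> grid_per N"
  unfolding dy_def using grid_per_shift [of \<phi> N 0 1]
  by (simp add: grid_per_def)

lemma laplacian_h_grid_per:
  assumes "\<phi> \<in> grid_per N"
  shows "laplacian_h h \<phi> \<in> grid_per N"
  using grid_per_shift [OF assms, of 1 0] grid_per_shift [OF assms, of "-1" 0]
    grid_per_shift [OF assms, of 0 1] grid_per_shift [OF assms, of 0 "-1"] assms
  unfolding grid_per_def laplacian_h_def by simp

lemma laplacian_h_diff:
  "laplacian_h h (\<lambda>i j. \<phi> i j - \<psi> i j) i j = laplacian_h h \<phi> i j - laplacian_h h \<psi> i j"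
  by (cases "h = 0") (simp_all add: laplacian_h_def field_simps)

lemma laplacian_h_add_cmult:
  "laplacian_h h (\<lambda>i j. \<phi> i j + t * \<psi> i j) i j = laplacian_h h \<phi> i j + t * laplacian_h h \<psi> i j"
  by (cases "h = 0") (simp_all add: laplacian_h_def field_simps)

text \<open>\<open>P\<close> and \<open>Q\<close> are \<phi> times the backward differences of
  \<psi>. Their forward differences sum to zero by periodicity, and by the discrete product rule
  they differ from \<open>\<phi> * \<Delta>\<psi>\<close> only by the products of gradients.\<close>

lemma summation_by_parts:
  assumes "\<phi> \<in> grid_per N" "\<psi> \<in> grid_per N" "h \<noteq> 0"
  shows "gsum N (\<lambda>i j. \<phi> i j * laplacian_h h \<psi> i j) = - dirichlet N \<phi> \<psi> / h\<^sup>2"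
proof -
  define P where "P = (\<lambda>i j. \<phi> i j * (\<psi> i j - \<psi> (i - 1) j))"
  define Q where "Q = (\<lambda>i j. \<phi> i j * (\<psi> i j - \<psi> i (j - 1)))"
  have P: "P \<in> grid_per N" and Q: "Q \<in> grid_per N"
    unfolding P_def Q_def
    using assms grid_per_shift [OF assms(2), of "-1" 0] grid_per_shift [OF assms(2), of 0 "-1"]
    by (simp_all add: grid_per_def)
  have lap: "h\<^sup>2 * laplacian_h h \<psi> i j =
      \<psi> (i + 1) j + \<psi> (i - 1) j + \<psi> i (j + 1) + \<psi> i (j - 1) - 4 * \<psi> i j" for i j
    using assms(3) by (simp add: laplacian_h_def)
  \<comment> \<open>The summands \<open>+ 0\<close> are spelled out so that both shifted terms match
    \<open>gsum_shift\<close>.\<close>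
  have eq: "h\<^sup>2 * (\<phi> i j * laplacian_h h \<psi> i j) =
      ((P (i + 1) (j + 0) - P i j) + (Q (i + 0) (j + 1) - Q i j))
      - (dx \<phi> i j * dx \<psi> i j + dy \<phi> i j * dy \<psi> i j)" for i j
    unfolding mult.left_commute [of "h\<^sup>2"] lap
    by (simp add: P_def Q_def dx_def dy_def algebra_simps)
  have "h\<^sup>2 * gsum N (\<lambda>i j. \<phi> i j * laplacian_h h \<psi> i j) = - dirichlet N \<phi> \<psi>"
    unfolding gsum_cmult [symmetric] eq gsum_diff gsum_add gsum_shift [OF P] gsum_shift [OF Q]
      dirichlet_def by simp
  then show ?thesis using assms(3) by (simp add: field_simps)
qed

lemma dirichlet_commute: "dirichlet N \<phi> \<psi> = dirichlet N \<psi> \<phi>"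
  by (simp add: dirichlet_def mult.commute)

lemma dirichlet_nonneg: "0 \<le> dirichlet N \<phi> \<phi>"
  unfolding dirichlet_def by (rule gsum_nonneg) simp

lemma dirichlet_add_cmult:
  "dirichlet N (\<lambda>i j. \<phi> i j + t * \<psi> i j) (\<lambda>i j. \<phi> i j + t * \<psi> i j) =
    dirichlet N \<phi> \<phi> + 2 * t * dirichlet N \<phi> \<psi> + t\<^sup>2 * dirichlet N \<psi> \<psi>"
  unfolding dirichlet_def gsum_cmult [symmetric] gsum_add [symmetric]
  by (simp add: dx_def dy_def algebra_simps power2_eq_square)

text \<open>Testing with the constant 1 kills the Dirichlet form; this is mass conservation for the
  scheme.\<close>

lemma gsum_laplacian_h:
  assumes "\<phi> \<in> grid_per N" "h \<noteq> 0"
  shows "gsum N (laplacian_h h \<phi>) = 0"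
proof -
  have "(\<lambda>i j. 1) \<in> grid_per N" by (simp add: grid_per_def)
  from summation_by_parts [OF this assms] show ?thesis
    by (simp add: dirichlet_def dx_def dy_def gsum_const)
qed

lemma laplacian_h_symmetric:
  assumes "\<phi> \<in> grid_per N" "\<psi> \<in> grid_per N" "h \<noteq> 0"
  shows "gsum N (\<lambda>i j. \<phi> i j * laplacian_h h \<psi> i j) = gsum N (\<lambda>i j. laplacian_h h \<phi> i j * \<psi> i j)"
  using summation_by_parts [OF assms] summation_by_parts [OF assms(2,1,3)]
  by (simp add: dirichlet_commute mult.commute)

text \<open>Coercivity for the minimisation below, in place of a Poincare inequality. Every single
  difference is at most \<open>c\<close>; walking from the origin along row zero and then along a
  column adds up at most \<open>\<bar>i\<bar> + \<bar>j\<bar>\<close> of them. That the bound grows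
  with the index does no harm, since compactness in the product topology needs only a bound for each
  coordinate.\<close>

lemma abs_le_of_dirichlet_le:
  assumes "\<phi> \<in> grid_per N" "N \<ge> 1" "dirichlet N \<phi> \<phi> \<le> c\<^sup>2" "c \<ge> 0" "\<phi> 0 0 = 0"
  shows "\<bar>\<phi> i j\<bar> \<le> (\<bar>of_int i\<bar> + \<bar>of_int j\<bar>) * c"
proof -
  have "(\<lambda>i j. dx \<phi> i j * dx \<phi> i j + dy \<phi> i j * dy \<phi> i j) \<in> grid_per N"
    using dx_grid_per [OF assms(1)] dy_grid_per [OF assms(1)] by (simp add: grid_per_def)
  then have le: "(dx \<phi> i j)\<^sup>2 + (dy \<phi> i j)\<^sup>2 \<le> c\<^sup>2" for i j
    using le_gsum [of "\<lambda>i j. dx \<phi> i j * dx \<phi> i j + dy \<phi> i j * dy \<phi> i j" N i j] assms(2,3)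
    by (simp add: dirichlet_def power2_eq_square)
  have "(dx \<phi> i j)\<^sup>2 \<le> c\<^sup>2" "(dy \<phi> i j)\<^sup>2 \<le> c\<^sup>2" for i j
    using le [of i j] zero_le_power2 [of "dx \<phi> i j"] zero_le_power2 [of "dy \<phi> i j"] by linarith+
  then have dx: "\<bar>\<phi> (i + 1) j - \<phi> i j\<bar> \<le> c" and dy: "\<bar>\<phi> i (j + 1) - \<phi> i j\<bar> \<le> c" for i j
    using assms(4) by (simp_all add: abs_le_square_iff [symmetric] dx_def dy_def)
  have row: "\<bar>\<phi> i 0\<bar> \<le> \<bar>of_int i\<bar> * c" for i
  proof (induction i rule: int_induct [where k = 0])
    case (step1 i)
    have "\<bar>of_int (i + 1)\<bar> * c = \<bar>of_int i\<bar> * c + c"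
      using step1(1) by (simp add: algebra_simps)
    then show ?case using dx [of i 0] step1(2) by linarith
  next
    case (step2 i)
    have "\<bar>of_int (i - 1)\<bar> * c = \<bar>of_int i\<bar> * c + c"
      using step2(1) by (simp add: algebra_simps)
    then show ?case using dx [of "i - 1" 0] step2(2) by simp
  qed (simp add: assms(5))
  show ?thesis
  proof (induction j rule: int_induct [where k = 0])
    case base
    show ?case using row [of i] by simp
  next
    case (step1 j)
    have "\<bar>of_int (j + 1)\<bar> * c = \<bar>of_int j\<bar> * c + c"
      using step1(1) by (simp add: algebra_simps)
    then show ?case using dy [of i j] step1(2) by (simp add: distrib_right)
  next
    case (step2 j)
    have "\<bar>of_int (j - 1)\<bar> * c = \<bar>of_int j\<bar> * c + c"
      using step2(1) by (simp add: algebra_simps)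
    then show ?case using dy [of i "j - 1"] step2(2) by (simp add: distrib_right)
  qed
qed


section \<open>Convolution with an even periodic kernel\<close>

lemma gsum_mult_square_le:
  assumes "\<And>i j. \<bar>A i j\<bar> \<le> m"
  shows "(gsum N (\<lambda>k l. A k l * \<phi> k l))\<^sup>2 \<le> (real N)\<^sup>2 * m\<^sup>2 * gsum N (\<lambda>k l. (\<phi> k l)\<^sup>2)"
proof -
  have "m \<ge> 0" using assms [of 0 0] by linarith
  have "(gsum N (\<lambda>k l. A k l * \<phi> k l))\<^sup>2 \<le> (real N)\<^sup>2 * gsum N (\<lambda>k l. (A k l * \<phi> k l)\<^sup>2)"
    by (rule gsum_squared_le)
  also have "gsum N (\<lambda>k l. (A k l * \<phi> k l)\<^sup>2) \<le> gsum N (\<lambda>k l. m\<^sup>2 * (\<phi> k l)\<^sup>2)"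
    using assms \<open>m \<ge> 0\<close>
    by (intro gsum_mono) (simp add: power_mult_distrib mult_right_mono abs_le_square_iff [symmetric])
  finally show ?thesis by (simp add: gsum_cmult mult_left_mono mult.assoc)
qed

locale even_kernel =
  fixes N :: nat and K :: grid_fun
  assumes N_ge_1: "N \<ge> 1"
    and K_per: "K \<in> grid_per N"
    and K_even: "K (- i) (- j) = K i j"
begin

text \<open>The shift sits on the kernel, whereas the scheme has it on the grid function. So
  \<open>C \<phi>\<close> is periodic for every \<phi>, and differences of \<open>C \<phi>\<close>
  become differences of \<open>K\<close>; for periodic \<phi> the two forms agree by
  \<open>C_altdef\<close>.\<close>

definition C :: "grid_fun \<Rightarrow> grid_fun" where
  "C \<phi> = (\<lambda>i j. gsum N (\<lambda>k l. K (i - k) (j - l) * \<phi> k l))"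

lemma K_translate_per: "(\<lambda>k l. K (a + k) (b + l)) \<in> grid_per N"
  using grid_per_shift [OF K_per, of a b] by (simp add: add.commute)

lemma K_reflect_per: "(\<lambda>k l. K (a - k) (b - l)) \<in> grid_per N"
proof -
  have "(\<lambda>k l. K (a - k) (b - l)) = (\<lambda>k l. K (- a + k) (- b + l))"
  proof (intro ext)
    show "K (a - k) (b - l) = K (- a + k) (- b + l)" for k l
      using K_even [of "a - k" "b - l"] by (simp add: algebra_simps)
  qed
  then show ?thesis by (simp only: K_translate_per)
qed

lemma C_altdef:
  assumes "\<phi> \<in> grid_per N"
  shows "C \<phi> i j = gsum N (\<lambda>k l. K k l * \<phi> (i - k) (j - l))"
proof -
  have "(\<lambda>k l. K (i - k) (j - l) * \<phi> k l) \<in> grid_per N"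
    using K_reflect_per [of i j] assms by (simp add: grid_per_def)
  from gsum_reflect [OF this, of i j] show ?thesis by (simp add: C_def)
qed

lemma C_grid_per: "C \<phi> \<in> grid_per N"
proof -
  have "K (i + int N - k) (j - l) = K (i - k) (j - l)" for i j k l
    using grid_perD(1) [OF K_per, of "i - k" "j - l"] by (simp add: algebra_simps)
  moreover have "K (i - k) (j + int N - l) = K (i - k) (j - l)" for i j k l
    using grid_perD(2) [OF K_per, of "i - k" "j - l"] by (simp add: algebra_simps)
  ultimately show ?thesis by (simp add: C_def grid_per_def)
qed

lemma C_diff: "C (\<lambda>i j. \<phi> i j - \<psi> i j) i j = C \<phi> i j - C \<psi> i j"
  by (simp add: C_def gsum_diff [symmetric] algebra_simps)

lemma C_add_cmult: "C (\<lambda>i j. \<phi> i j + t * \<psi> i j) i j = C \<phi> i j + t * C \<psi> i j"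
  by (simp add: C_def gsum_add [symmetric] gsum_cmult [symmetric] algebra_simps)

text \<open>Evenness makes the matrix \<open>K (i - k) (j - l)\<close> symmetric. This is what makes
  \<open>chem\<close> the gradient of \<open>energy\<close>.\<close>

lemma C_symmetric: "gsum N (\<lambda>i j. \<phi> i j * C \<psi> i j) = gsum N (\<lambda>i j. C \<phi> i j * \<psi> i j)"
proof -
  have K: "K (i - k) (j - l) = K (k - i) (l - j)" for i j k l
    using K_even [of "i - k" "j - l"] by simp
  have "gsum N (\<lambda>i j. \<phi> i j * C \<psi> i j)
      = gsum N (\<lambda>i j. gsum N (\<lambda>k l. \<phi> i j * (K (i - k) (j - l) * \<psi> k l)))"
    by (simp add: C_def gsum_cmult)
  also have "\<dots> = gsum N (\<lambda>k l. gsum N (\<lambda>i j. \<psi> k l * (K (k - i) (l - j) * \<phi> i j)))"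
    by (subst gsum_swap) (simp add: K mult.commute mult.left_commute)
  also have "\<dots> = gsum N (\<lambda>i j. C \<phi> i j * \<psi> i j)"
    by (simp add: C_def gsum_cmult mult.commute)
  finally show ?thesis .
qed

text \<open>Summation by parts against \<open>w = \<tau> \<Delta>\<theta>\<close> leaves a difference of \<open>C w\<close>, which falls on the kernel
  because \<open>C\<close> is a convolution.\<close>

lemma convolution_estimate:
  assumes \<theta>: "\<theta> \<in> grid_per N" and "h > 0" "\<tau> > 0"
    and w: "\<And>i j. w i j = \<tau> * laplacian_h h \<theta> i j"
    and mx: "\<And>i j. \<bar>K (i + 1) j - K i j\<bar> \<le> m" and my: "\<And>i j. \<bar>K i (j + 1) - K i j\<bar> \<le> m"
  shows "\<kappa> * gsum N (\<lambda>i j. w i j * C w i j) \<le>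
     \<tau> / h\<^sup>2 * dirichlet N \<theta> \<theta> +
     \<tau> * \<kappa>\<^sup>2 / (2 * h\<^sup>2) * real N ^ 4 * m\<^sup>2 * gsum N (\<lambda>i j. (w i j)\<^sup>2)"
proof -
  define W where "W = gsum N (\<lambda>i j. (w i j)\<^sup>2)"
  have dxC: "(dx (C w) i j)\<^sup>2 \<le> (real N)\<^sup>2 * m\<^sup>2 * W" for i j
  proof -
    have "dx (C w) i j = gsum N (\<lambda>k l. (K (i - k + 1) (j - l) - K (i - k) (j - l)) * w k l)"
      by (simp add: dx_def C_def gsum_diff [symmetric] algebra_simps)
    then show ?thesis using gsum_mult_square_le [of "\<lambda>k l. K (i - k + 1) (j - l) - K (i - k) (j - l)" m N w]
      by (simp add: mx W_def)
  qed
  have dyC: "(dy (C w) i j)\<^sup>2 \<le> (real N)\<^sup>2 * m\<^sup>2 * W" for i j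
  proof -
    have "dy (C w) i j = gsum N (\<lambda>k l. (K (i - k) (j - l + 1) - K (i - k) (j - l)) * w k l)"
      by (simp add: dy_def C_def gsum_diff [symmetric] algebra_simps)
    then show ?thesis using gsum_mult_square_le [of "\<lambda>k l. K (i - k) (j - l + 1) - K (i - k) (j - l)" m N w]
      by (simp add: my W_def)
  qed
  \<comment> \<open>The weights give \<open>a\<^sup>2\<close> the coefficient 1, so that the
    gradient of \<theta> appears with exactly the factor \<open>\<tau> / h\<^sup>2\<close> that the
    dissipation can absorb.\<close>
  have amgm: "- \<kappa> * (a * b) \<le> a\<^sup>2 + \<kappa>\<^sup>2 / 4 * b\<^sup>2" for a b :: real
    using zero_le_power2 [of "a + \<kappa> / 2 * b"] by (simp add: power2_eq_square algebra_simps)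
  have "- \<kappa> * dirichlet N (C w) \<theta> =
      gsum N (\<lambda>i j. - \<kappa> * (dx \<theta> i j * dx (C w) i j) + - \<kappa> * (dy \<theta> i j * dy (C w) i j))"
    unfolding dirichlet_def gsum_cmult [symmetric] by (simp add: algebra_simps)
  also have "\<dots> \<le> gsum N (\<lambda>i j. (dx \<theta> i j * dx \<theta> i j + dy \<theta> i j * dy \<theta> i j) +
      \<kappa>\<^sup>2 / 2 * ((real N)\<^sup>2 * m\<^sup>2 * W))"
  proof (rule gsum_mono)
    fix i j
    have "\<kappa>\<^sup>2 / 4 * (dx (C w) i j)\<^sup>2 \<le> \<kappa>\<^sup>2 / 4 * ((real N)\<^sup>2 * m\<^sup>2 * W)"
      "\<kappa>\<^sup>2 / 4 * (dy (C w) i j)\<^sup>2 \<le> \<kappa>\<^sup>2 / 4 * ((real N)\<^sup>2 * m\<^sup>2 * W)"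
      by (intro mult_left_mono dxC dyC; simp)+
    then show "- \<kappa> * (dx \<theta> i j * dx (C w) i j) + - \<kappa> * (dy \<theta> i j * dy (C w) i j) \<le>
        (dx \<theta> i j * dx \<theta> i j + dy \<theta> i j * dy \<theta> i j) + \<kappa>\<^sup>2 / 2 * ((real N)\<^sup>2 * m\<^sup>2 * W)"
      using amgm [of "dx \<theta> i j" "dx (C w) i j"] amgm [of "dy \<theta> i j" "dy (C w) i j"]
      unfolding power2_eq_square [of "dx \<theta> i j"] power2_eq_square [of "dy \<theta> i j"] by linarith
  qed
  \<comment> \<open>One factor \<open>(real N)\<^sup>2\<close> comes from Cauchy-Schwarz inside the
    convolution, the other from summing a constant over the grid.\<close>
  also have "\<dots> = dirichlet N \<theta> \<theta> + \<kappa>\<^sup>2 / 2 * real N ^ 4 * m\<^sup>2 * W"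
    unfolding gsum_add [where g = "\<lambda>_ _. \<kappa>\<^sup>2 / 2 * ((real N)\<^sup>2 * m\<^sup>2 * W)"] gsum_const
      dirichlet_def [symmetric]
    by (simp add: power4_eq_xxxx power2_eq_square)
  finally have main: "- \<kappa> * dirichlet N (C w) \<theta> \<le>
      dirichlet N \<theta> \<theta> + \<kappa>\<^sup>2 / 2 * real N ^ 4 * m\<^sup>2 * W" .
  have "gsum N (\<lambda>i j. w i j * C w i j) = \<tau> * gsum N (\<lambda>i j. C w i j * laplacian_h h \<theta> i j)"
    unfolding gsum_cmult [symmetric] by (simp add: w mult.commute mult.left_commute)
  also have "\<dots> = \<tau> / h\<^sup>2 * - dirichlet N (C w) \<theta>"
    using summation_by_parts [OF C_grid_per \<theta>] \<open>h > 0\<close> by simp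
  finally have "\<kappa> * gsum N (\<lambda>i j. w i j * C w i j) = \<tau> / h\<^sup>2 * (- \<kappa> * dirichlet N (C w) \<theta>)"
    by simp
  also have "\<dots> \<le> \<tau> / h\<^sup>2 * (dirichlet N \<theta> \<theta> + \<kappa>\<^sup>2 / 2 * real N ^ 4 * m\<^sup>2 * W)"
    using \<open>h > 0\<close> \<open>\<tau> > 0\<close> by (intro mult_left_mono main) simp
  finally show ?thesis using \<open>h > 0\<close> by (simp add: W_def field_simps)
qed

section \<open>Energy decay and uniqueness for one step\<close>

definition chem :: "real \<Rightarrow> real \<Rightarrow> grid_fun \<Rightarrow> grid_fun" where
  "chem \<gamma> \<kappa> u = (\<lambda>i j. u i j ^ 3 + \<gamma> * u i j - \<kappa> * C u i j)"

text \<open>Here \<gamma> stands for \<open>gamma_h\<close> and \<kappa> for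
  \<open>\<epsilon>\<^sup>2\<close>. The concave part \<open>- r\<^sup>2 / 2\<close> of the
  potential is merged with the local convolution term into \<open>\<gamma> / 2 * r\<^sup>2\<close>,
  which leaves only convex local terms when \<gamma> is nonnegative.\<close>

definition energy :: "real \<Rightarrow> real \<Rightarrow> grid_fun \<Rightarrow> real" where
  "energy \<gamma> \<kappa> u =
     gsum N (\<lambda>i j. u i j ^ 4 / 4 + \<gamma> / 2 * (u i j)\<^sup>2) - \<kappa> / 2 * gsum N (\<lambda>i j. u i j * C u i j)"

lemma chem_grid_per: "u \<in> grid_per N \<Longrightarrow> chem \<gamma> \<kappa> u \<in> grid_per N"
  using C_grid_per [of u] by (simp add: chem_def grid_per_def)

text \<open>An exact Taylor polynomial in \<open>t\<close>, with \<open>chem\<close> as gradient. It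
  is used at \<open>t = -1\<close> for energy decay and near \<open>t = 0\<close> for the critical
  point equation.\<close>

lemma energy_expand:
  "energy \<gamma> \<kappa> (\<lambda>i j. u i j + t * d i j) =
     energy \<gamma> \<kappa> u + t * gsum N (\<lambda>i j. chem \<gamma> \<kappa> u i j * d i j)
     + t\<^sup>2 * (gsum N (\<lambda>i j. 3 / 2 * (u i j)\<^sup>2 * (d i j)\<^sup>2 + \<gamma> / 2 * (d i j)\<^sup>2)
             - \<kappa> / 2 * gsum N (\<lambda>i j. d i j * C d i j))
     + t ^ 3 * gsum N (\<lambda>i j. u i j * d i j ^ 3) + t ^ 4 * gsum N (\<lambda>i j. d i j ^ 4 / 4)"
proof -
  have "gsum N (\<lambda>i j. (u i j + t * d i j) * C (\<lambda>i j. u i j + t * d i j) i j) =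
      gsum N (\<lambda>i j. u i j * C u i j) + t * gsum N (\<lambda>i j. u i j * C d i j)
      + t * gsum N (\<lambda>i j. C u i j * d i j) + t\<^sup>2 * gsum N (\<lambda>i j. d i j * C d i j)"
    unfolding C_add_cmult gsum_cmult [symmetric] gsum_add [symmetric]
    by (simp add: algebra_simps power2_eq_square)
  also have "gsum N (\<lambda>i j. u i j * C d i j) = gsum N (\<lambda>i j. C u i j * d i j)"
    by (rule C_symmetric)
  finally have conv: "gsum N (\<lambda>i j. (u i j + t * d i j) * C (\<lambda>i j. u i j + t * d i j) i j) =
      gsum N (\<lambda>i j. u i j * C u i j) + 2 * t * gsum N (\<lambda>i j. C u i j * d i j)
      + t\<^sup>2 * gsum N (\<lambda>i j. d i j * C d i j)" by simp
  \<comment> \<open>Here \<open>c\<close> is the value of \<open>C u\<close> at the grid point. The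
    term with \<open>c\<close> is inserted to complete \<open>chem\<close> and cancels against the
    mixed term of \<open>conv\<close>.\<close>
  have loc: "(x + t * y) ^ 4 / 4 + \<gamma> / 2 * (x + t * y)\<^sup>2 = x ^ 4 / 4 + \<gamma> / 2 * x\<^sup>2
      + t * ((x ^ 3 + \<gamma> * x - \<kappa> * c) * y) + \<kappa> * t * (c * y)
      + t\<^sup>2 * (3 / 2 * x\<^sup>2 * y\<^sup>2 + \<gamma> / 2 * y\<^sup>2) + t ^ 3 * (x * y ^ 3) + t ^ 4 * (y ^ 4 / 4)"
    for x y c :: real
    by (simp add: field_simps power2_eq_square power3_eq_cube power4_eq_xxxx)
  have "gsum N (\<lambda>i j. (u i j + t * d i j) ^ 4 / 4 + \<gamma> / 2 * (u i j + t * d i j)\<^sup>2) =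
      gsum N (\<lambda>i j. u i j ^ 4 / 4 + \<gamma> / 2 * (u i j)\<^sup>2)
      + t * gsum N (\<lambda>i j. chem \<gamma> \<kappa> u i j * d i j) + \<kappa> * t * gsum N (\<lambda>i j. C u i j * d i j)
      + t\<^sup>2 * gsum N (\<lambda>i j. 3 / 2 * (u i j)\<^sup>2 * (d i j)\<^sup>2 + \<gamma> / 2 * (d i j)\<^sup>2)
      + t ^ 3 * gsum N (\<lambda>i j. u i j * d i j ^ 3) + t ^ 4 * gsum N (\<lambda>i j. d i j ^ 4 / 4)"
    unfolding gsum_cmult [symmetric] gsum_add [symmetric] chem_def
    by (intro arg_cong [of _ _ "gsum N"] ext loc)
  then show ?thesis
    unfolding energy_def conv by (simp add: algebra_simps)
qed

text \<open>Expanding around the new iterate makes the linear term the full dissipation. The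
  convolution term carries a factor one half, so the estimate consumes only half of the dissipation
  and all of \<open>\<gamma> / 2 * D\<close>.\<close>

lemma energy_stable:
  assumes u: "u \<in> grid_per N" and \<omega>: "\<omega> \<in> grid_per N" and "h > 0" "\<tau> > 0"
    and eq: "\<And>i j. u i j - v i j = \<tau> * laplacian_h h \<omega> i j"
    and chem: "\<And>i j. \<omega> i j = chem \<gamma> \<kappa> u i j"
    and mx: "\<And>i j. \<bar>K (i + 1) j - K i j\<bar> \<le> m" and my: "\<And>i j. \<bar>K i (j + 1) - K i j\<bar> \<le> m"
    and small: "\<tau> * \<kappa>\<^sup>2 / (2 * h\<^sup>2) * real N ^ 4 * m\<^sup>2 \<le> \<gamma>"
  shows "energy \<gamma> \<kappa> u \<le> energy \<gamma> \<kappa> v"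
proof -
  define d where "d = (\<lambda>i j. \<tau> * laplacian_h h \<omega> i j)"
  define D where "D = gsum N (\<lambda>i j. (d i j)\<^sup>2)"
  have v: "v = (\<lambda>i j. u i j + (-1) * d i j)"
    using eq by (auto simp: fun_eq_iff d_def algebra_simps)
  have "\<kappa> * gsum N (\<lambda>i j. d i j * C d i j) \<le> \<tau> / h\<^sup>2 * dirichlet N \<omega> \<omega> +
      \<tau> * \<kappa>\<^sup>2 / (2 * h\<^sup>2) * real N ^ 4 * m\<^sup>2 * D"
    unfolding D_def
    by (rule convolution_estimate [OF \<omega> \<open>h > 0\<close> \<open>\<tau> > 0\<close> _ mx my]) (simp add: d_def)
  also have "\<dots> \<le> \<tau> / h\<^sup>2 * dirichlet N \<omega> \<omega> + \<gamma> * D"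
    using small by (intro add_left_mono mult_right_mono) (simp_all add: D_def gsum_nonneg)
  finally have conv: "\<kappa> * gsum N (\<lambda>i j. d i j * C d i j) \<le> \<tau> / h\<^sup>2 * dirichlet N \<omega> \<omega> + \<gamma> * D" .
  have "gsum N (\<lambda>i j. chem \<gamma> \<kappa> u i j * d i j) = \<tau> * gsum N (\<lambda>i j. \<omega> i j * laplacian_h h \<omega> i j)"
    unfolding gsum_cmult [symmetric] by (simp add: d_def chem mult.left_commute)
  also have "\<dots> = - (\<tau> / h\<^sup>2 * dirichlet N \<omega> \<omega>)"
    using summation_by_parts [OF \<omega> \<omega>] \<open>h > 0\<close> by simp
  finally have lin: "gsum N (\<lambda>i j. chem \<gamma> \<kappa> u i j * d i j) = - (\<tau> / h\<^sup>2 * dirichlet N \<omega> \<omega>)" .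
  \<comment> \<open>The excess of \<open>(x - y) ^ 4 / 4\<close> over its tangent at
    \<open>x\<close>, nonnegative by convexity.\<close>
  have pos: "0 \<le> 3 / 2 * x\<^sup>2 * y\<^sup>2 - x * y ^ 3 + y ^ 4 / 4" for x y :: real
  proof -
    have "3 / 2 * x\<^sup>2 * y\<^sup>2 - x * y ^ 3 + y ^ 4 / 4 = (x * y)\<^sup>2 / 2 + (x * y - y\<^sup>2 / 2)\<^sup>2"
      by (simp add: field_simps power2_eq_square power3_eq_cube power4_eq_xxxx)
    then show ?thesis by simp
  qed
  have "0 \<le> gsum N (\<lambda>i j. 3 / 2 * (u i j)\<^sup>2 * (d i j)\<^sup>2 - u i j * d i j ^ 3 + d i j ^ 4 / 4)"
    by (rule gsum_nonneg) (rule pos)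
  then have quad: "0 \<le> gsum N (\<lambda>i j. 3 / 2 * (u i j)\<^sup>2 * (d i j)\<^sup>2)
      - gsum N (\<lambda>i j. u i j * d i j ^ 3) + gsum N (\<lambda>i j. d i j ^ 4 / 4)"
    by (simp only: gsum_add gsum_diff)
  have "energy \<gamma> \<kappa> v - energy \<gamma> \<kappa> u = \<tau> / h\<^sup>2 * dirichlet N \<omega> \<omega> + \<gamma> / 2 * D
      - \<kappa> / 2 * gsum N (\<lambda>i j. d i j * C d i j)
      + (gsum N (\<lambda>i j. 3 / 2 * (u i j)\<^sup>2 * (d i j)\<^sup>2)
      - gsum N (\<lambda>i j. u i j * d i j ^ 3) + gsum N (\<lambda>i j. d i j ^ 4 / 4))"
    unfolding v energy_expand lin gsum_add gsum_cmult D_def by simp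
  moreover have "0 \<le> \<tau> / h\<^sup>2 * dirichlet N \<omega> \<omega>"
    using \<open>\<tau> > 0\<close> dirichlet_nonneg by simp
  ultimately show ?thesis using conv quad by linarith
qed

text \<open>Pairing the difference \<theta> of the chemical potentials with the difference
  \<open>w\<close> of the solutions, the estimate may use up both the dissipation and the term with
  \<gamma>. What remains is the monotone cubic part; its strictness yields equality even when the
  time step bound is attained.\<close>

lemma step_unique:
  assumes u: "u \<in> grid_per N" "u' \<in> grid_per N" and "h > 0" "\<tau> > 0"
    and eq: "\<And>i j. u i j - v i j = \<tau> * laplacian_h h (chem \<gamma> \<kappa> u) i j"
      "\<And>i j. u' i j - v i j = \<tau> * laplacian_h h (chem \<gamma> \<kappa> u') i j"
    and mx: "\<And>i j. \<bar>K (i + 1) j - K i j\<bar> \<le> m" and my: "\<And>i j. \<bar>K i (j + 1) - K i j\<bar> \<le> m"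
    and small: "\<tau> * \<kappa>\<^sup>2 / (2 * h\<^sup>2) * real N ^ 4 * m\<^sup>2 \<le> \<gamma>"
  shows "u = u'"
proof -
  define \<theta> where "\<theta> = (\<lambda>i j. chem \<gamma> \<kappa> u i j - chem \<gamma> \<kappa> u' i j)"
  define w where "w = (\<lambda>i j. u i j - u' i j)"
  define W where "W = gsum N (\<lambda>i j. (w i j)\<^sup>2)"
  define P where "P = (\<lambda>i j. (u i j ^ 3 - u' i j ^ 3) * w i j)"
  have \<theta>: "\<theta> \<in> grid_per N" and P: "P \<in> grid_per N"
    using u chem_grid_per [OF u(1)] chem_grid_per [OF u(2)]
    by (simp_all add: \<theta>_def w_def P_def grid_per_def)
  have w: "w i j = \<tau> * laplacian_h h \<theta> i j" for i j
    using eq [of i j] unfolding \<theta>_def laplacian_h_diff w_def by (simp add: algebra_simps)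
  have "\<kappa> * gsum N (\<lambda>i j. w i j * C w i j) \<le> \<tau> / h\<^sup>2 * dirichlet N \<theta> \<theta> +
      \<tau> * \<kappa>\<^sup>2 / (2 * h\<^sup>2) * real N ^ 4 * m\<^sup>2 * W"
    unfolding W_def by (rule convolution_estimate [OF \<theta> \<open>h > 0\<close> \<open>\<tau> > 0\<close> w mx my])
  also have "\<dots> \<le> \<tau> / h\<^sup>2 * dirichlet N \<theta> \<theta> + \<gamma> * W"
    using small by (intro add_left_mono mult_right_mono) (simp_all add: W_def gsum_nonneg)
  finally have conv: "\<kappa> * gsum N (\<lambda>i j. w i j * C w i j) \<le> \<tau> / h\<^sup>2 * dirichlet N \<theta> \<theta> + \<gamma> * W" .
  have \<theta>_eq: "\<theta> i j = u i j ^ 3 - u' i j ^ 3 + \<gamma> * w i j - \<kappa> * C w i j" for i j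
    unfolding w_def C_diff \<theta>_def chem_def by (simp add: algebra_simps)
  have "\<theta> i j * w i j = P i j + \<gamma> * (w i j)\<^sup>2 - \<kappa> * (w i j * C w i j)" for i j
    unfolding \<theta>_eq P_def by (simp add: algebra_simps power2_eq_square)
  then have "gsum N (\<lambda>i j. \<theta> i j * w i j) = gsum N P + \<gamma> * W - \<kappa> * gsum N (\<lambda>i j. w i j * C w i j)"
    by (simp add: gsum_add gsum_diff gsum_cmult W_def)
  moreover have "gsum N (\<lambda>i j. \<theta> i j * w i j) = \<tau> * gsum N (\<lambda>i j. \<theta> i j * laplacian_h h \<theta> i j)"
    unfolding gsum_cmult [symmetric] by (simp add: w mult.left_commute)
  then have "gsum N (\<lambda>i j. \<theta> i j * w i j) = - (\<tau> / h\<^sup>2 * dirichlet N \<theta> \<theta>)"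
    using summation_by_parts [OF \<theta> \<theta>] \<open>h > 0\<close> by simp
  ultimately have "gsum N P \<le> 0" using conv by linarith
  \<comment> \<open>If the product vanishes, then either \<open>x = y\<close> directly or the second
    factor forces \<open>x = y = 0\<close>.\<close>
  have cube: "(x ^ 3 - y ^ 3) * (x - y) = (x - y)\<^sup>2 * ((x + y)\<^sup>2 + x\<^sup>2 + y\<^sup>2) / 2"
    for x y :: real
    by (simp add: field_simps power2_eq_square power3_eq_cube)
  have "0 \<le> P i j" for i j unfolding P_def w_def cube by simp
  with \<open>gsum N P \<le> 0\<close> have "P i j = 0" for i j
    using gsum_eq_0D [OF P N_ge_1] by blast
  moreover have "u i j = u' i j" if "P i j = 0" for i j
    using that unfolding P_def w_def cube by (auto simp: add_nonneg_eq_0_iff)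
  ultimately show ?thesis by blast
qed

section \<open>Existence for one step by minimisation\<close>

lemma energy_bounded_below:
  assumes "\<gamma> \<ge> 0"
  obtains b where "\<And>u. b \<le> energy \<gamma> \<kappa> u"
proof
  define M where "M = gsum N (\<lambda>i j. \<bar>K i j\<bar>)"
  \<comment> \<open>\<open>B * U\<close> dominates the convolution term; the square of
    \<open>r\<^sup>2 / 2 - B\<close> then shows that the quartic outweighs it up to
    \<open>B\<^sup>2\<close> per cell.\<close>
  define B where "B = \<bar>\<kappa>\<bar> / 2 * (M\<^sup>2 * real N ^ 4 + 1)"
  have M: "\<bar>K i j\<bar> \<le> M" for i j
    unfolding M_def using grid_per_map [OF K_per, of abs] N_ge_1
    by (rule le_gsum [of "\<lambda>i j. \<bar>K i j\<bar>"]) simp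
  show "- ((real N)\<^sup>2 * B\<^sup>2) \<le> energy \<gamma> \<kappa> u" for u
  proof -
    define U where "U = gsum N (\<lambda>i j. (u i j)\<^sup>2)"
    have CU: "(C u i j)\<^sup>2 \<le> (real N)\<^sup>2 * M\<^sup>2 * U" for i j
      using gsum_mult_square_le [of "\<lambda>k l. K (i - k) (j - l)" M N u] by (simp add: C_def M U_def)
    have "\<bar>u i j * C u i j\<bar> \<le> (u i j)\<^sup>2 + (real N)\<^sup>2 * M\<^sup>2 * U" for i j
    proof -
      have "2 * \<bar>u i j * C u i j\<bar> \<le> (u i j)\<^sup>2 + (C u i j)\<^sup>2"
        using sum_squares_bound [of "\<bar>u i j\<bar>" "\<bar>C u i j\<bar>"] by (simp add: abs_mult)
      then show ?thesis using CU [of i j] by linarith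
    qed
    then have "gsum N (\<lambda>i j. \<bar>u i j * C u i j\<bar>) \<le> gsum N (\<lambda>i j. (u i j)\<^sup>2 + (real N)\<^sup>2 * M\<^sup>2 * U)"
      by (intro gsum_mono)
    also have "\<dots> = (M\<^sup>2 * real N ^ 4 + 1) * U"
      unfolding gsum_add gsum_const U_def [symmetric]
      by (simp add: algebra_simps power4_eq_xxxx power2_eq_square [of "real N"])
    finally have "\<bar>gsum N (\<lambda>i j. u i j * C u i j)\<bar> \<le> (M\<^sup>2 * real N ^ 4 + 1) * U"
      using abs_gsum_le [of N "\<lambda>i j. u i j * C u i j"] by linarith
    then have "\<bar>\<kappa>\<bar> / 2 * \<bar>gsum N (\<lambda>i j. u i j * C u i j)\<bar> \<le> B * U"
      unfolding B_def mult.assoc [of _ _ U] by (intro mult_left_mono) auto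
    then have "\<kappa> / 2 * gsum N (\<lambda>i j. u i j * C u i j) \<le> B * U"
      by (simp add: abs_mult [symmetric])
    moreover have "gsum N (\<lambda>i j. - B\<^sup>2 + B * (u i j)\<^sup>2) \<le>
        gsum N (\<lambda>i j. u i j ^ 4 / 4 + \<gamma> / 2 * (u i j)\<^sup>2)"
    proof (rule gsum_mono)
      fix i j
      have "0 \<le> ((u i j)\<^sup>2 / 2 - B)\<^sup>2" "0 \<le> \<gamma> / 2 * (u i j)\<^sup>2" using assms by simp_all
      then show "- B\<^sup>2 + B * (u i j)\<^sup>2 \<le> u i j ^ 4 / 4 + \<gamma> / 2 * (u i j)\<^sup>2"
        by (simp add: power2_eq_square power4_eq_xxxx algebra_simps)
    qed
    ultimately show ?thesis
      unfolding energy_def gsum_add [of N "\<lambda>i j. - B\<^sup>2"] gsum_const gsum_cmult U_def by linarith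
  qed
qed

end

lemma continuous_on_grid_coordinate: "continuous_on S (\<lambda>\<phi>::grid_fun. \<phi> i j)"
  by (rule continuous_on_product_then_coordinatewise [OF continuous_on_product_then_coordinatewise])
    (rule continuous_on_id)

lemma continuous_on_gsum:
  "(\<And>i j. continuous_on S (\<lambda>\<phi>. f \<phi> i j)) \<Longrightarrow> continuous_on S (\<lambda>\<phi>. gsum N (f \<phi>))"
  unfolding gsum_def case_prod_unfold by (intro continuous_on_sum)

text \<open>Tychonoff: a product of intervals over all integer indices, cut by the closed condition
  of periodicity. No passage to finitely many coordinates is required.\<close>

lemma compact_grid_box:
  "compact {\<phi> \<in> grid_per N. \<forall>i j. \<bar>\<phi> i j\<bar> \<le> B i j}"
proof -
  have *: "compact (PiE UNIV S)" if "\<And>i. compact (S i)"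
    for S :: "int \<Rightarrow> 'a::topological_space set"
    using that compactin_PiE [of "\<lambda>_. euclidean" UNIV S]
    by (simp add: euclidean_product_topology flip: compactin_euclidean_iff)
  have "compact (PiE UNIV (\<lambda>i. PiE UNIV (\<lambda>j. {- B i j..B i j})) :: grid_fun set)"
    by (intro * compact_Icc)
  moreover have "closed (grid_per N)"
    unfolding grid_per_def
    by (intro closed_Collect_all closed_Collect_conj closed_Collect_eq continuous_on_grid_coordinate)
  ultimately have "compact (PiE UNIV (\<lambda>i. PiE UNIV (\<lambda>j. {- B i j..B i j})) \<inter> grid_per N)"
    by (rule compact_Int_closed)
  also have "PiE UNIV (\<lambda>i. PiE UNIV (\<lambda>j. {- B i j..B i j})) \<inter> grid_per N =
      {\<phi> \<in> grid_per N. \<forall>i j. \<bar>\<phi> i j\<bar> \<le> B i j}"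
    by (auto simp: PiE_UNIV_domain Pi_iff abs_le_iff minus_le_iff)
  finally show ?thesis .
qed

lemma quartic_nonneg_imp_linear_coeff_zero:
  fixes b :: real
  assumes "\<And>t. 0 \<le> t * b + t\<^sup>2 * c + t ^ 3 * d + t ^ 4 * e"
  shows "b = 0"
proof -
  have "((\<lambda>t. t * b + t\<^sup>2 * c + t ^ 3 * d + t ^ 4 * e) has_real_derivative b) (at 0)"
    by (auto intro!: derivative_eq_intros)
  then show ?thesis
    by (rule DERIV_local_min [of _ _ _ 1]) (use assms in auto)
qed

context even_kernel
begin

text \<open>With \<open>u = v + \<tau> \<Delta>\<omega>\<close>, critical points of \<open>\<tau>/2 |\<nabla>\<omega>|\<^sup>2 + E(u)\<close> satisfy
  \<open>\<Delta>(chem u - \<omega>) = 0\<close>, and adjusting \<open>\<omega>\<close> by a constant gives a solution of the scheme.\<close>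

lemma step_exists:
  assumes v: "v \<in> grid_per N" and "h > 0" "\<tau> > 0" "\<gamma> \<ge> 0"
  obtains u where "u \<in> grid_per N"
    "\<And>i j. u i j - v i j = \<tau> * laplacian_h h (chem \<gamma> \<kappa> u) i j"
proof -
  define upd where "upd = (\<lambda>\<omega> i j. v i j + \<tau> * laplacian_h h \<omega> i j)"
  define H where "H = (\<lambda>\<omega>. \<tau> / (2 * h\<^sup>2) * dirichlet N \<omega> \<omega> + energy \<gamma> \<kappa> (upd \<omega>))"
  obtain b where b: "b \<le> energy \<gamma> \<kappa> u" for u using energy_bounded_below [OF \<open>\<gamma> \<ge> 0\<close>] by blast
  \<comment> \<open>The radius beyond which the Dirichlet term alone, together with the lower bound
    \<open>b\<close>, lifts \<open>H\<close> above its value at zero.\<close>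
  define c where "c = sqrt ((H (\<lambda>_ _. 0) - b) / (\<tau> / (2 * h\<^sup>2)))"
  define Q where "Q = {\<phi> \<in> grid_per N. \<forall>i j. \<bar>\<phi> i j\<bar> \<le> (\<bar>of_int i\<bar> + \<bar>of_int j\<bar>) * c}"
  have pos: "\<tau> / (2 * h\<^sup>2) > 0" using assms by simp
  have H0: "H (\<lambda>_ _. 0) - b \<ge> 0"
    using b [of "upd (\<lambda>_ _. 0)"] by (simp add: H_def dirichlet_def dx_def dy_def gsum_const)
  have c: "c \<ge> 0" "c\<^sup>2 = (H (\<lambda>_ _. 0) - b) / (\<tau> / (2 * h\<^sup>2))"
    using divide_nonneg_pos [OF H0 pos] by (simp_all add: c_def)
  have zero: "(\<lambda>_ _. 0) \<in> Q" using c by (simp add: Q_def grid_per_def)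
  have "continuous_on Q H"
    unfolding H_def energy_def upd_def dirichlet_def C_def laplacian_h_def dx_def dy_def
    using \<open>h > 0\<close>
    by (intro continuous_intros continuous_on_gsum continuous_on_grid_coordinate) auto
  moreover have "compact Q" unfolding Q_def by (rule compact_grid_box)
  ultimately obtain \<omega> where \<omega>Q: "\<omega> \<in> Q" and min: "\<And>\<psi>. \<psi> \<in> Q \<Longrightarrow> H \<omega> \<le> H \<psi>"
    using continuous_attains_inf [of Q H] zero by blast
  have \<omega>: "\<omega> \<in> grid_per N" using \<omega>Q by (simp add: Q_def)
  \<comment> \<open>\<open>H\<close> sees only differences, so \<psi> may be normalised to vanish at
    the origin. It then lies in \<open>Q\<close> or exceeds the radius, where \<open>H\<close> is
    larger than at zero.\<close>
  have H_min: "H \<omega> \<le> H \<psi>" if \<psi>: "\<psi> \<in> grid_per N" for \<psi>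
  proof -
    define \<psi>' where "\<psi>' = (\<lambda>i j. \<psi> i j - \<psi> 0 0)"
    have \<psi>': "\<psi>' \<in> grid_per N" using \<psi> by (simp add: \<psi>'_def grid_per_def)
    have "laplacian_h h \<psi>' = laplacian_h h \<psi>" "dx \<psi>' = dx \<psi>" "dy \<psi>' = dy \<psi>"
      by (simp_all add: \<psi>'_def laplacian_h_def dx_def dy_def algebra_simps)
    then have H_eq: "H \<psi>' = H \<psi>" by (simp add: H_def upd_def dirichlet_def)
    show ?thesis
    proof (cases "dirichlet N \<psi>' \<psi>' \<le> c\<^sup>2")
      case True
      then have "\<psi>' \<in> Q"
        using abs_le_of_dirichlet_le [OF \<psi>' N_ge_1 True c(1)] \<psi>' by (simp add: Q_def \<psi>'_def)
      then show ?thesis using min H_eq by metis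
    next
      case False
      then have "H (\<lambda>_ _. 0) - b < \<tau> / (2 * h\<^sup>2) * dirichlet N \<psi>' \<psi>'"
        unfolding c not_le pos_divide_less_eq [OF pos] by (simp only: mult.commute)
      then have "H (\<lambda>_ _. 0) < H \<psi>'" using b [of "upd \<psi>'"] unfolding H_def by linarith
      then show ?thesis using min [OF zero] H_eq by linarith
    qed
  qed
  define u where "u = upd \<omega>"
  define p where "p = (\<lambda>i j. chem \<gamma> \<kappa> u i j - \<omega> i j)"
  \<comment> \<open>This single test direction suffices: stationarity gives
    \<open>(p | \<Delta>\<eta>) = 0\<close>, and by symmetry of the Laplacian the left side is the
    sum of the squares of \<eta>.\<close>
  define \<eta> where "\<eta> = laplacian_h h p"
  have u: "u \<in> grid_per N"
    using v laplacian_h_grid_per [OF \<omega>] by (simp add: u_def upd_def grid_per_def)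
  have p: "p \<in> grid_per N" using chem_grid_per [OF u] \<omega> by (simp add: p_def grid_per_def)
  have \<eta>: "\<eta> \<in> grid_per N" unfolding \<eta>_def by (rule laplacian_h_grid_per [OF p])
  define d where "d = (\<lambda>i j. \<tau> * laplacian_h h \<eta> i j)"
  have upd_eq: "upd (\<lambda>i j. \<omega> i j + t * \<eta> i j) = (\<lambda>i j. u i j + t * d i j)" for t
    unfolding upd_def laplacian_h_add_cmult u_def d_def by (simp add: algebra_simps)
  have "\<tau> / (2 * h\<^sup>2) * (2 * dirichlet N \<omega> \<eta>) + gsum N (\<lambda>i j. chem \<gamma> \<kappa> u i j * d i j) = 0"
  proof (rule quartic_nonneg_imp_linear_coeff_zero)
    fix t
    have "(\<lambda>i j. \<omega> i j + t * \<eta> i j) \<in> grid_per N" using \<omega> \<eta> by (simp add: grid_per_def)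
    then have "0 \<le> H (\<lambda>i j. \<omega> i j + t * \<eta> i j) - H \<omega>" using H_min by simp
    then show "0 \<le> t * (\<tau> / (2 * h\<^sup>2) * (2 * dirichlet N \<omega> \<eta>) + gsum N (\<lambda>i j. chem \<gamma> \<kappa> u i j * d i j))
      + t\<^sup>2 * (\<tau> / (2 * h\<^sup>2) * dirichlet N \<eta> \<eta>
          + (gsum N (\<lambda>i j. 3 / 2 * (u i j)\<^sup>2 * (d i j)\<^sup>2 + \<gamma> / 2 * (d i j)\<^sup>2)
             - \<kappa> / 2 * gsum N (\<lambda>i j. d i j * C d i j)))
      + t ^ 3 * gsum N (\<lambda>i j. u i j * d i j ^ 3) + t ^ 4 * gsum N (\<lambda>i j. d i j ^ 4 / 4)"
      unfolding H_def upd_eq energy_expand dirichlet_add_cmult u_def [symmetric]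
      by (simp add: algebra_simps)
  qed
  moreover have "\<tau> / (2 * h\<^sup>2) * (2 * dirichlet N \<omega> \<eta>) =
      - (\<tau> * gsum N (\<lambda>i j. \<omega> i j * laplacian_h h \<eta> i j))"
    using summation_by_parts [OF \<omega> \<eta>] \<open>h > 0\<close> by simp
  moreover have "gsum N (\<lambda>i j. chem \<gamma> \<kappa> u i j * d i j) =
      \<tau> * gsum N (\<lambda>i j. chem \<gamma> \<kappa> u i j * laplacian_h h \<eta> i j)"
    unfolding gsum_cmult [symmetric] d_def by (simp add: mult.left_commute)
  moreover have "gsum N (\<lambda>i j. p i j * laplacian_h h \<eta> i j) =
      gsum N (\<lambda>i j. chem \<gamma> \<kappa> u i j * laplacian_h h \<eta> i j) - gsum N (\<lambda>i j. \<omega> i j * laplacian_h h \<eta> i j)"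
    unfolding p_def left_diff_distrib gsum_diff ..
  ultimately have "gsum N (\<lambda>i j. p i j * laplacian_h h \<eta> i j) = 0" using \<open>\<tau> > 0\<close> by simp
  then have "gsum N (\<lambda>i j. (\<eta> i j)\<^sup>2) = 0"
    using laplacian_h_symmetric [OF p \<eta>] \<open>h > 0\<close> by (simp add: \<eta>_def power2_eq_square)
  then have "(\<eta> i j)\<^sup>2 = 0" for i j
    by (intro gsum_eq_0D [OF grid_per_map [OF \<eta>] N_ge_1]) auto
  then have "laplacian_h h (chem \<gamma> \<kappa> u) i j = laplacian_h h \<omega> i j" for i j
    using laplacian_h_diff [of h "chem \<gamma> \<kappa> u" \<omega> i j] by (simp add: \<eta>_def p_def)
  then have "u i j - v i j = \<tau> * laplacian_h h (chem \<gamma> \<kappa> u) i j" for i j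
    by (simp add: u_def upd_def)
  with u show ?thesis by (rule that)
qed

end

section \<open>From the smooth kernel to its samples\<close>

lemma C1_directional_lipschitz:
  fixes f :: "'a::euclidean_space \<Rightarrow> real"
  assumes "Ck (Suc 0) f" "compact S" "convex S"
  obtains M where "M > 0"
    "\<And>p t. \<lbrakk>p \<in> S; p + t *\<^sub>R e \<in> S; t \<ge> 0\<rbrakk> \<Longrightarrow> \<bar>f (p + t *\<^sub>R e) - f p\<bar> \<le> M * t"
proof -
  define f' where "f' = (\<lambda>p. frechet_derivative f (at p) e)"
  have deriv: "(f has_derivative frechet_derivative f (at p)) (at p)" for p
    using assms(1) by (simp add: frechet_derivative_works)
  \<comment> \<open>\<open>Ck\<close> asserts continuity of the derivative only in each fixed
    direction, which is why the bound is for one direction \<open>e\<close> at a time.\<close>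
  have "continuous_on S f'"
    using assms(1) by (auto simp: f'_def intro: continuous_on_subset)
  then have "bounded (f' ` S)"
    using assms(2) by (intro compact_imp_bounded compact_continuous_image)
  then obtain M where M: "M > 0" "\<And>p. p \<in> S \<Longrightarrow> \<bar>f' p\<bar> \<le> M"
    by (auto simp: bounded_pos)
  show ?thesis
  proof (rule that [OF M(1)])
    fix p and t :: real
    assume p: "p \<in> S" "p + t *\<^sub>R e \<in> S" and t: "t \<ge> 0"
    have line: "((\<lambda>s. f (p + s *\<^sub>R e)) has_real_derivative f' (p + s *\<^sub>R e)) (at s within {0..t})" for s
    proof -
      have "((\<lambda>s. p + s *\<^sub>R e) has_derivative (\<lambda>s. s *\<^sub>R e)) (at s within {0..t})"
        by (auto intro!: derivative_eq_intros)
      from has_derivative_compose [OF this deriv]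
      have "((\<lambda>s. f (p + s *\<^sub>R e)) has_derivative
          (\<lambda>r. frechet_derivative f (at (p + s *\<^sub>R e)) (r *\<^sub>R e))) (at s within {0..t})" .
      moreover have "frechet_derivative f (at q) (r *\<^sub>R e) = f' q * r" for q r
        using linear_scale [OF has_derivative_linear [OF deriv]] by (simp add: f'_def)
      ultimately show ?thesis by (simp add: has_field_derivative_def)
    qed
    have inS: "p + s *\<^sub>R e \<in> S" if "s \<in> {0..t}" for s
    proof (cases "t = 0")
      case False
      have "p + s *\<^sub>R e = (1 - s / t) *\<^sub>R p + (s / t) *\<^sub>R (p + t *\<^sub>R e)"
        using False by (simp add: algebra_simps)
      then show ?thesis
        using convexD [OF assms(3) p, of "1 - s / t" "s / t"] that False t by simp
    qed (use that p in auto)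
    have "norm (f (p + t *\<^sub>R e) - f (p + 0 *\<^sub>R e)) \<le> M * norm (t - 0)"
      by (rule field_differentiable_bound [of "{0..t}" "\<lambda>s. f (p + s *\<^sub>R e)" "\<lambda>s. f' (p + s *\<^sub>R e)"])
        (use line inS M t in auto)
    then show "\<bar>f (p + t *\<^sub>R e) - f p\<bar> \<le> M * t" using t by simp
  qed
qed

text \<open>The indicator of failure is a nonnegative periodic grid function with sum zero, hence
  vanishes everywhere; this replaces reducing indices modulo \<open>N\<close>.\<close>

lemma grid_per_all:
  assumes "\<phi> \<in> grid_per N" "N \<ge> 1" "\<And>i j. \<lbrakk>i \<in> {1..int N}; j \<in> {1..int N}\<rbrakk> \<Longrightarrow> P (\<phi> i j)"
  shows "P (\<phi> a b)"
proof -
  have "gsum N (\<lambda>i j. of_bool (\<not> P (\<phi> i j))) = 0"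
    unfolding gsum_def using assms(3) by (intro sum.neutral) auto
  then have "of_bool (\<not> P (\<phi> a b)) = (0::real)"
    by (intro gsum_eq_0D [OF grid_per_map [OF assms(1), of "\<lambda>x. of_bool (\<not> P x)"] assms(2)])
      simp_all
  then show ?thesis by simp
qed

definition sampled_kernel :: "real \<Rightarrow> (real \<times> real \<Rightarrow> real) \<Rightarrow> grid_fun" where
  "sampled_kernel h J = (\<lambda>k l. h\<^sup>2 * J (of_int k * h, of_int l * h))"

locale periodic_kernel =
  fixes L :: real and J :: "real \<times> real \<Rightarrow> real" and N :: nat and h :: real
  assumes L_pos: "L > 0"
    and J_per_x: "J (x + L, y) = J (x, y)"
    and J_per_y: "J (x, y + L) = J (x, y)"
    and J_even: "J (- p) = J p"
    and N_pos: "N \<ge> 1"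
    and h_eq: "h = L / real N"
begin

lemma h_pos: "h > 0" and N_mult_h: "real N * h = L"
  using L_pos N_pos by (simp_all add: h_eq)

sublocale even_kernel N "sampled_kernel h J"
proof
  show "sampled_kernel h J \<in> grid_per N"
    by (simp add: sampled_kernel_def grid_per_def distrib_right N_mult_h J_per_x J_per_y)
  show "sampled_kernel h J (- i) (- j) = sampled_kernel h J i j" for i j
    using J_even [of "(of_int i * h, of_int j * h)"] by (simp add: sampled_kernel_def)
qed (rule N_pos)

lemma conv_h_eq_C:
  assumes "\<phi> \<in> grid_per N"
  shows "conv_h h N J \<phi> = C \<phi>"
  by (intro ext, subst C_altdef [OF assms])
    (simp add: conv_h_def gsum_nested sampled_kernel_def sum_distrib_left mult.assoc)

lemma energy_h_eq:
  assumes "u \<in> grid_per N"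
  shows "energy_h h N J \<epsilon> u =
    h\<^sup>2 * (energy (gamma_h h N J \<epsilon>) (\<epsilon>\<^sup>2) u + (real N)\<^sup>2 / 4)"
proof -
  define U where "U = gsum N (\<lambda>i j. (u i j)\<^sup>2)"
  have "gsum N (\<lambda>i j. potential (u i j)) =
      gsum N (\<lambda>i j. u i j ^ 4 / 4 + (- 1 / 2) * (u i j)\<^sup>2 + 1 / 4)"
    by (intro arg_cong [of _ _ "gsum N"] ext)
      (simp add: potential_def field_simps power2_eq_square power4_eq_xxxx)
  also have "\<dots> = gsum N (\<lambda>i j. u i j ^ 4 / 4) - U / 2 + (real N)\<^sup>2 / 4"
    unfolding gsum_add gsum_cmult gsum_const by (simp add: U_def)
  finally have pot: "gsum N (\<lambda>i j. potential (u i j)) =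
    gsum N (\<lambda>i j. u i j ^ 4 / 4) - U / 2 + (real N)\<^sup>2 / 4" .
  have norm: "(grid_norm2 h N u)\<^sup>2 = h\<^sup>2 * U"
    by (simp add: grid_norm2_def grid_inner_eq_gsum U_def gsum_nonneg power2_eq_square)
  show ?thesis
    unfolding energy_h_def energy_def grid_inner_eq_gsum norm mult_1_right pot gamma_h_def
      conv_h_eq_C [OF assms] gsum_add gsum_cmult U_def [symmetric]
    by (simp add: field_simps)
qed

text \<open>\<omega> is determined by \<open>u\<close>, so unique solvability for pairs reduces to
  one equation for \<open>u\<close>.\<close>

lemma backward_euler_step_iff:
  assumes "\<tau> > 0"
  shows "backward_euler_step h N J \<epsilon> \<tau> v u \<omega> \<longleftrightarrow>
    u \<in> grid_per N \<and> \<omega> = chem (gamma_h h N J \<epsilon>) (\<epsilon>\<^sup>2) u \<and>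
    (\<forall>i j. u i j - v i j = \<tau> * laplacian_h h (chem (gamma_h h N J \<epsilon>) (\<epsilon>\<^sup>2) u) i j)"
proof (cases "u \<in> grid_per N")
  case True
  have "(\<forall>i j. \<omega> i j = deriv potential (u i j) + \<epsilon>\<^sup>2 * conv_h_one h N J * u i j
      - \<epsilon>\<^sup>2 * conv_h h N J u i j) \<longleftrightarrow> \<omega> = chem (gamma_h h N J \<epsilon>) (\<epsilon>\<^sup>2) u"
    by (simp add: fun_eq_iff deriv_potential conv_h_eq_C [OF True] chem_def gamma_h_def
        algebra_simps)
  moreover have "a / \<tau> = b \<longleftrightarrow> a = \<tau> * b" for a b using assms by (auto simp: field_simps)
  ultimately show ?thesis
    using True chem_grid_per [OF True] by (auto simp: backward_euler_step_def)
qed (simp add: backward_euler_step_def)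

text \<open>The quadrature weight \<open>h\<^sup>2\<close> and the step \<open>h\<close> combine to
  \<open>h ^ 3\<close>. Samples with indices from 1 to \<open>N\<close> lie in \<open>[0, L]\<close>
  and their neighbours in \<open>[0, 2 * L]\<close>, since \<open>h\<close> is at most
  \<open>L\<close>; periodicity covers all other indices.\<close>

lemma sampled_kernel_slopes:
  assumes M: "\<And>p e t. \<lbrakk>e \<in> {(1, 0), (0, 1)}; p \<in> {0..2 * L} \<times> {0..2 * L};
      p + t *\<^sub>R e \<in> {0..2 * L} \<times> {0..2 * L}; t \<ge> 0\<rbrakk> \<Longrightarrow> \<bar>J (p + t *\<^sub>R e) - J p\<bar> \<le> M * t"
  shows "\<bar>sampled_kernel h J (i + 1) j - sampled_kernel h J i j\<bar> \<le> h ^ 3 * M"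
    and "\<bar>sampled_kernel h J i (j + 1) - sampled_kernel h J i j\<bar> \<le> h ^ 3 * M"
proof -
  have range: "0 \<le> of_int k * h" "of_int k * h \<le> L" "of_int k * h + h \<le> 2 * L"
    if "k \<in> {1..int N}" for k
  proof -
    have "of_int k * h \<le> real N * h" "1 * h \<le> real N * h" "0 \<le> of_int k * h"
      using that h_pos N_pos by (simp_all add: mult_right_mono)
    then show "0 \<le> of_int k * h" "of_int k * h \<le> L" "of_int k * h + h \<le> 2 * L"
      using N_mult_h by simp_all
  qed
  have scale: "\<bar>h\<^sup>2 * a - h\<^sup>2 * b\<bar> \<le> h ^ 3 * M" if "\<bar>a - b\<bar> \<le> M * h" for a b
    using mult_left_mono [OF that, of "h\<^sup>2"] unfolding right_diff_distrib [symmetric] abs_mult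
    by (simp add: power2_eq_square power3_eq_cube mult_ac)
  have "\<bar>dx (sampled_kernel h J) i j\<bar> \<le> h ^ 3 * M"
  proof (rule grid_per_all [OF dx_grid_per [OF K_per] N_pos, where P = "\<lambda>a. \<bar>a\<bar> \<le> h ^ 3 * M"])
    fix k l assume "k \<in> {1..int N}" "l \<in> {1..int N}"
    then show "\<bar>dx (sampled_kernel h J) k l\<bar> \<le> h ^ 3 * M"
      using M [of "(1, 0)" "(of_int k * h, of_int l * h)" h] range [of k] range [of l] h_pos L_pos
      by (auto simp: dx_def sampled_kernel_def distrib_right intro!: scale)
  qed
  then show "\<bar>sampled_kernel h J (i + 1) j - sampled_kernel h J i j\<bar> \<le> h ^ 3 * M"
    by (simp add: dx_def)
  have "\<bar>dy (sampled_kernel h J) i j\<bar> \<le> h ^ 3 * M"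
  proof (rule grid_per_all [OF dy_grid_per [OF K_per] N_pos, where P = "\<lambda>a. \<bar>a\<bar> \<le> h ^ 3 * M"])
    fix k l assume "k \<in> {1..int N}" "l \<in> {1..int N}"
    then show "\<bar>dy (sampled_kernel h J) k l\<bar> \<le> h ^ 3 * M"
      using M [of "(0, 1)" "(of_int k * h, of_int l * h)" h] range [of k] range [of l] h_pos L_pos
      by (auto simp: dy_def sampled_kernel_def distrib_right intro!: scale)
  qed
  then show "\<bar>sampled_kernel h J i (j + 1) - sampled_kernel h J i j\<bar> \<le> h ^ 3 * M"
    by (simp add: dy_def)
qed

text \<open>All powers of \<open>h\<close> combine with \<open>real N ^ 4\<close> into
  \<open>(real N * h) ^ 4 = L ^ 4\<close>. This is the reason that the constant does not depend on
  the mesh.\<close>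

lemma time_step_small:
  assumes "M > 0" "\<epsilon> > 0" "\<tau> \<le> 2 * \<gamma> / (L ^ 4 * M\<^sup>2 * \<epsilon> ^ 4)"
  shows "\<tau> * (\<epsilon>\<^sup>2)\<^sup>2 / (2 * h\<^sup>2) * real N ^ 4 * (h ^ 3 * M)\<^sup>2 \<le> \<gamma>"
proof -
  have "\<tau> * (\<epsilon>\<^sup>2)\<^sup>2 / (2 * h\<^sup>2) * real N ^ 4 * (h ^ 3 * M)\<^sup>2 = \<tau> * \<epsilon> ^ 4 * (real N * h) ^ 4 * M\<^sup>2 / 2"
    using h_pos by (simp add: field_simps eval_nat_numeral)
  also have "\<dots> = \<tau> * (L ^ 4 * M\<^sup>2 * \<epsilon> ^ 4) / 2" unfolding N_mult_h by simp
  also have "\<dots> \<le> \<gamma>" using assms L_pos by (simp add: pos_le_divide_eq)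
  finally show ?thesis .
qed

end

theorem theorem3p3:
  fixes L :: real and J :: "real \<times> real \<Rightarrow> real"
  assumes "L > 0"
    and "smooth J"
    and "\<And>x y. J (x + L, y) = J (x, y)"
    and "\<And>x y. J (x, y + L) = J (x, y)"
    and "\<And>p. J (- p) = J p"
    and "integral ({0<..<L} \<times> {0<..<L}) J > 0"
  shows "(\<forall>(N::nat) (h::real) (\<epsilon>::real) (\<tau>::real) u \<omega>.
            N \<ge> 1 \<longrightarrow> h = L / real N \<longrightarrow> \<epsilon> > 0 \<longrightarrow> \<tau> > 0 \<longrightarrow>
            gamma_cont L J \<epsilon> > 0 \<longrightarrow> gamma_h h N J \<epsilon> > 0 \<longrightarrow>
            backward_euler h N J \<epsilon> \<tau> u \<omega> \<longrightarrow>
            (\<forall>n. grid_inner N (\<lambda>i j. u (Suc n) i j - u n i j) (\<lambda>_ _. 1) = 0))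
       \<and> (\<exists>C\<^sub>J>0. \<forall>(N::nat) (h::real) (\<epsilon>::real) (\<tau>::real).
            N \<ge> 1 \<longrightarrow> h = L / real N \<longrightarrow> \<epsilon> > 0 \<longrightarrow> \<tau> > 0 \<longrightarrow>
            gamma_cont L J \<epsilon> > 0 \<longrightarrow> gamma_h h N J \<epsilon> > 0 \<longrightarrow>
            \<tau> \<le> 2 * gamma_h h N J \<epsilon> / (C\<^sub>J * \<epsilon> ^ 4) \<longrightarrow>
            (\<forall>v\<in>grid_per N. \<exists>!(u, \<omega>). backward_euler_step h N J \<epsilon> \<tau> v u \<omega>) \<and>
            (\<forall>u \<omega>. backward_euler h N J \<epsilon> \<tau> u \<omega> \<longrightarrow>
               (\<forall>n. energy_h h N J \<epsilon> (u (Suc n)) \<le> energy_h h N J \<epsilon> (u n))))"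
proof (intro conjI)
  have ker: "periodic_kernel L J N h" if "N \<ge> 1" "h = L / real N" for N h
    using assms(1,3-5) that by unfold_locales auto
  show "\<forall>(N::nat) (h::real) (\<epsilon>::real) (\<tau>::real) u \<omega>.
            N \<ge> 1 \<longrightarrow> h = L / real N \<longrightarrow> \<epsilon> > 0 \<longrightarrow> \<tau> > 0 \<longrightarrow>
            gamma_cont L J \<epsilon> > 0 \<longrightarrow> gamma_h h N J \<epsilon> > 0 \<longrightarrow>
            backward_euler h N J \<epsilon> \<tau> u \<omega> \<longrightarrow>
            (\<forall>n. grid_inner N (\<lambda>i j. u (Suc n) i j - u n i j) (\<lambda>_ _. 1) = 0)"
  proof (intro allI impI)
    fix N h \<epsilon> \<tau> u \<omega> n
    assume N: "N \<ge> 1" "h = L / real N" and \<tau>: "\<tau> > 0" and be: "backward_euler h N J \<epsilon> \<tau> u \<omega>"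
    interpret periodic_kernel L J N h by (rule ker [OF N])
    have step: "backward_euler_step h N J \<epsilon> \<tau> (u n) (u (Suc n)) (\<omega> (Suc n))"
      using be by (simp add: backward_euler_def)
    define \<mu> where "\<mu> = chem (gamma_h h N J \<epsilon>) (\<epsilon>\<^sup>2) (u (Suc n))"
    have "\<mu> \<in> grid_per N" and eq: "\<And>i j. u (Suc n) i j - u n i j = \<tau> * laplacian_h h \<mu> i j"
      using step chem_grid_per unfolding backward_euler_step_iff [OF \<tau>] \<mu>_def by blast+
    then show "grid_inner N (\<lambda>i j. u (Suc n) i j - u n i j) (\<lambda>_ _. 1) = 0"
      using gsum_laplacian_h [of \<mu> N h] h_pos unfolding grid_inner_eq_gsum eq
      by (simp add: gsum_cmult)
  qed
  have C1: "Ck (Suc 0) J" using assms(2) by (simp only: smooth_def)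
  have cube: "compact ({0..2 * L} \<times> {0..2 * L})" "convex ({0..2 * L} \<times> {0..2 * L})"
    by (intro compact_Times compact_Icc convex_Times convex_real_interval)+
  obtain M1 where M1: "M1 > 0"
    "\<And>p t. \<lbrakk>p \<in> {0..2 * L} \<times> {0..2 * L}; p + t *\<^sub>R (1, 0) \<in> {0..2 * L} \<times> {0..2 * L}; t \<ge> 0\<rbrakk>
      \<Longrightarrow> \<bar>J (p + t *\<^sub>R (1, 0)) - J p\<bar> \<le> M1 * t"
    using C1_directional_lipschitz [OF C1 cube] by metis
  obtain M2 where M2: "M2 > 0"
    "\<And>p t. \<lbrakk>p \<in> {0..2 * L} \<times> {0..2 * L}; p + t *\<^sub>R (0, 1) \<in> {0..2 * L} \<times> {0..2 * L}; t \<ge> 0\<rbrakk>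
      \<Longrightarrow> \<bar>J (p + t *\<^sub>R (0, 1)) - J p\<bar> \<le> M2 * t"
    using C1_directional_lipschitz [OF C1 cube] by metis
  define M where "M = max M1 M2"
  have M_pos: "M > 0" using M1(1) by (simp add: M_def)
  have M: "\<bar>J (p + t *\<^sub>R e) - J p\<bar> \<le> M * t"
    if e: "e \<in> {(1, 0), (0, 1)}" and "p \<in> {0..2 * L} \<times> {0..2 * L}"
      "p + t *\<^sub>R e \<in> {0..2 * L} \<times> {0..2 * L}" "t \<ge> 0" for p e t
  proof -
    have le: "M1 * t \<le> M * t" "M2 * t \<le> M * t"
      using that(4) by (auto simp: M_def intro: mult_right_mono)
    consider "e = (1, 0)" | "e = (0, 1)" using e by blast
    then show ?thesis
    proof cases
      case 1
      have "\<bar>J (p + t *\<^sub>R e) - J p\<bar> \<le> M1 * t" using that(2-4) unfolding 1 by (rule M1(2))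
      then show ?thesis using le by linarith
    next
      case 2
      have "\<bar>J (p + t *\<^sub>R e) - J p\<bar> \<le> M2 * t" using that(2-4) unfolding 2 by (rule M2(2))
      then show ?thesis using le by linarith
    qed
  qed
  show "\<exists>C\<^sub>J>0. \<forall>(N::nat) (h::real) (\<epsilon>::real) (\<tau>::real).
            N \<ge> 1 \<longrightarrow> h = L / real N \<longrightarrow> \<epsilon> > 0 \<longrightarrow> \<tau> > 0 \<longrightarrow>
            gamma_cont L J \<epsilon> > 0 \<longrightarrow> gamma_h h N J \<epsilon> > 0 \<longrightarrow>
            \<tau> \<le> 2 * gamma_h h N J \<epsilon> / (C\<^sub>J * \<epsilon> ^ 4) \<longrightarrow>
            (\<forall>v\<in>grid_per N. \<exists>!(u, \<omega>). backward_euler_step h N J \<epsilon> \<tau> v u \<omega>) \<and>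
            (\<forall>u \<omega>. backward_euler h N J \<epsilon> \<tau> u \<omega> \<longrightarrow>
               (\<forall>n. energy_h h N J \<epsilon> (u (Suc n)) \<le> energy_h h N J \<epsilon> (u n)))"
  proof (rule exI [of _ "L ^ 4 * M\<^sup>2"], rule conjI, goal_cases)
    case 1
    show ?case using assms(1) M_pos by simp
  next
    case 2
    show ?case
    proof (intro allI impI)
      fix N h \<epsilon> \<tau>
      assume N: "N \<ge> 1" "h = L / real N" and \<epsilon>: "\<epsilon> > 0" and \<tau>: "\<tau> > 0"
        and \<gamma>: "gamma_h h N J \<epsilon> > 0"
        and bound: "\<tau> \<le> 2 * gamma_h h N J \<epsilon> / (L ^ 4 * M\<^sup>2 * \<epsilon> ^ 4)"
      interpret periodic_kernel L J N h by (rule ker [OF N])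
      note slopes = sampled_kernel_slopes [OF M]
      note small = time_step_small [OF M_pos \<epsilon> bound]
      let ?\<mu> = "chem (gamma_h h N J \<epsilon>) (\<epsilon>\<^sup>2)"
      have "\<exists>!(u, \<omega>). backward_euler_step h N J \<epsilon> \<tau> v u \<omega>" if v: "v \<in> grid_per N" for v
      proof -
        obtain u where u: "u \<in> grid_per N"
          "\<And>i j. u i j - v i j = \<tau> * laplacian_h h (?\<mu> u) i j"
          using step_exists [OF v h_pos \<tau>, of "gamma_h h N J \<epsilon>"] \<gamma> by (metis less_imp_le)
        show ?thesis
        proof (rule ex1I [of _ "(u, ?\<mu> u)"])
          show "case (u, ?\<mu> u) of (u, \<omega>) \<Rightarrow> backward_euler_step h N J \<epsilon> \<tau> v u \<omega>"
            using u by (simp add: backward_euler_step_iff [OF \<tau>])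
        next
          fix q assume "case q of (u, \<omega>) \<Rightarrow> backward_euler_step h N J \<epsilon> \<tau> v u \<omega>"
          then obtain u' where q: "q = (u', ?\<mu> u')" and u': "u' \<in> grid_per N"
            "\<And>i j. u' i j - v i j = \<tau> * laplacian_h h (?\<mu> u') i j"
            by (auto simp: backward_euler_step_iff [OF \<tau>] split: prod.splits)
          have "u' = u"
            by (rule step_unique [OF u'(1) u(1) h_pos \<tau> u'(2) u(2) slopes small])
          then show "q = (u, ?\<mu> u)" using q by simp
        qed
      qed
      moreover have "energy_h h N J \<epsilon> (u (Suc n)) \<le> energy_h h N J \<epsilon> (u n)"
        if be: "backward_euler h N J \<epsilon> \<tau> u \<omega>" for u \<omega> n
      proof -
        have step: "backward_euler_step h N J \<epsilon> \<tau> (u n) (u (Suc n)) (\<omega> (Suc n))" for n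
          using be by (simp add: backward_euler_def)
        \<comment> \<open>Periodicity is a condition on the initial value and, for later iterates,
          part of the step that produced them.\<close>
        then have per: "u n \<in> grid_per N" for n
          using be by (cases n) (auto simp: backward_euler_def backward_euler_step_def)
        have "energy (gamma_h h N J \<epsilon>) (\<epsilon>\<^sup>2) (u (Suc n)) \<le> energy (gamma_h h N J \<epsilon>) (\<epsilon>\<^sup>2) (u n)"
          using step [of n] unfolding backward_euler_step_iff [OF \<tau>]
          by (intro energy_stable [OF per chem_grid_per [OF per] h_pos \<tau> _ refl slopes small]) blast
        then show ?thesis
          unfolding energy_h_eq [OF per] by (simp add: mult_left_mono)
      qed
      ultimately show "(\<forall>v\<in>grid_per N. \<exists>!(u, \<omega>). backward_euler_step h N J \<epsilon> \<tau> v u \<omega>) \<and>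
          (\<forall>u \<omega>. backward_euler h N J \<epsilon> \<tau> u \<omega> \<longrightarrow>
            (\<forall>n. energy_h h N J \<epsilon> (u (Suc n)) \<le> energy_h h N J \<epsilon> (u n)))"
        by blast
    qed
  qed
qed

end
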